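(* Let $k\ge 2$. An element $(g_1,g_2)\sigma^i$ of $B_k$, where $g_1,g_2\in B_{k-1}$ and $i\in\{0,1\}$, belongs to $G_k'$ if and only if $g_1,g_2\in G_{k-1}$ and $g_1g_2\in B_{k-1}'$.
   Context: For a group $G$, $G'=[G,G]$ is the derived (commutator) subgroup. $C_2=\langle\sigma\rangle$ with $\sigma=(1,2)$ acting on $\{1,2\}$. For a group $B$, elements of the permutational wreath product $B\wr C_2$ are written $(g_1,g_2)\pi$ with $g_1,g_2\in B$ and $\pi\in C_2$, with multiplication $(g_1,g_2)\pi_g\cdot(h_1,h_2)\pi_h=(g_1h_{\pi_g(1)},g_2h_{\pi_g(2)})\pi_g\pi_h$. Define recursively $B_1=C_2$ and $B_k=B_{k-1}\wr C_2$ for $k>1$. Define $G_1=\langle e\rangle$ (the trivial group) and $G_k=\{(g_1,g_2)\pi\in B_k \mid g_1g_2\in G_{k-1}\}$ for $k>1$; the group $G_k$ is isomorphic to a Sylow 2-subgroup of the alternating group $A_{2^k}$.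
   Formalization: The condition i = 0 is added to the right-hand side: for i = 1 no element belongs to G_k', although (e,e)σ satisfies g1,g2 ∈ G_{k-1} and g1g2 ∈ B_{k-1}' (already for k = 2, where G_2' is trivial). *)

theory Defs
  imports "HOL-Algebra.Algebra"
begin

definition sigma :: "nat \<Rightarrow> nat" where
  "sigma = Transposition.transpose 1 2"

definition C2 :: "(nat \<Rightarrow> nat) monoid" where
  "C2 = (sym_group 2)\<lparr>carrier := generate (sym_group 2) {sigma}\<rparr>"

text \<open>
  One type carries all the iterated wreath products: \<open>Base \<pi>\<close> is the element \<open>\<pi>\<close> of the
  bottom group \<open>C2\<close>, and \<open>Wr g1 g2 \<pi>\<close> is the wreath product element \<open>(g1, g2)\<pi>\<close>.
\<close>

datatype wr_elt = Base "nat \<Rightarrow> nat" | Wr wr_elt wr_elt "nat \<Rightarrow> nat"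

definition base_group :: "wr_elt monoid" where
  "base_group = \<lparr>carrier = Base ` carrier C2,
     monoid.mult = (\<lambda>x y. case (x, y) of (Base \<pi>, Base \<rho>) \<Rightarrow> Base (\<pi> \<otimes>\<^bsub>C2\<^esub> \<rho>) | _ \<Rightarrow> undefined),
     one = Base \<one>\<^bsub>C2\<^esub>\<rparr>"

definition coord :: "'a \<Rightarrow> 'a \<Rightarrow> nat \<Rightarrow> 'a" where
  "coord h1 h2 j = (if j = 1 then h1 else h2)"

definition wreath_C2 :: "wr_elt monoid \<Rightarrow> wr_elt monoid" where
  "wreath_C2 B = \<lparr>carrier = {Wr g1 g2 \<pi> | g1 g2 \<pi>. g1 \<in> carrier B \<and> g2 \<in> carrier B \<and> \<pi> \<in> carrier C2},
     monoid.mult = (\<lambda>x y. case (x, y) of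
       (Wr g1 g2 \<pi>, Wr h1 h2 \<rho>) \<Rightarrow>
         Wr (g1 \<otimes>\<^bsub>B\<^esub> coord h1 h2 (\<pi> 1)) (g2 \<otimes>\<^bsub>B\<^esub> coord h1 h2 (\<pi> 2)) (\<pi> \<otimes>\<^bsub>C2\<^esub> \<rho>)
       | _ \<Rightarrow> undefined),
     one = Wr \<one>\<^bsub>B\<^esub> \<one>\<^bsub>B\<^esub> \<one>\<^bsub>C2\<^esub>\<rparr>"

text \<open>The indices start at \<open>1\<close>; the values at index \<open>0\<close> are irrelevant.\<close>

fun Bgrp :: "nat \<Rightarrow> wr_elt monoid" where
  "Bgrp 0 = base_group"
| "Bgrp (Suc 0) = base_group"
| "Bgrp (Suc (Suc n)) = wreath_C2 (Bgrp (Suc n))"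

text \<open>\<open>Gsub k\<close> is the underlying set of \<open>G\<^sub>k\<close> as a subgroup of \<open>Bgrp k\<close>.\<close>

fun Gsub :: "nat \<Rightarrow> wr_elt set" where
  "Gsub 0 = {\<one>\<^bsub>Bgrp 0\<^esub>}"
| "Gsub (Suc 0) = {\<one>\<^bsub>Bgrp (Suc 0)\<^esub>}"
| "Gsub (Suc (Suc n)) =
     {Wr g1 g2 \<pi> | g1 g2 \<pi>. Wr g1 g2 \<pi> \<in> carrier (Bgrp (Suc (Suc n))) \<and>
        g1 \<otimes>\<^bsub>Bgrp (Suc n)\<^esub> g2 \<in> Gsub (Suc n)}"

end

theory Submission
  imports Defs
begin

text \<open>
  The subgroup \<open>G\<^sub>k\<close> has index at most two in \<open>B\<^sub>k\<close>; write \<open>B = B\<^bsub>k-1\<^esub>\<close> and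
  \<open>N = G\<^bsub>k-1\<^esub>\<close>. On \<open>G\<^sub>k\<close> the maps sending \<open>(a, b)\<pi>\<close> to \<open>\<pi>\<close>, to the class of \<open>a\<close> modulo \<open>N\<close>,
  and to the class of \<open>a b\<close> modulo \<open>B'\<close> are homomorphisms to abelian groups, so they kill \<open>G\<^sub>k'\<close>.
  Conversely, \<open>(a, b) = (a b, 1) (b\<^sup>-\<^sup>1, b)\<close>. For \<open>b \<in> N\<close> the second factor is the commutator of
  \<open>(b\<^sup>-\<^sup>1, 1)\<close> and \<open>\<sigma>\<close>. For the first factor it suffices to treat \<open>a b = [x, y]\<close>; since \<open>N\<close> has
  index at most two, one may assume \<open>y \<in> N\<close>, and then \<open>([x, y], 1)\<close> is the commutator of
  \<open>(x, x\<^sup>-\<^sup>1)\<close> and \<open>(y, 1)\<close>.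
\<close>

section \<open>Derived subgroups and maps to abelian groups\<close>

lemma derived_hom_comm_group:
  assumes "group G" "subgroup K G" "comm_group A" "h \<in> hom (G\<lparr>carrier := K\<rparr>) A"
    and "x \<in> derived G K"
  shows "h x = \<one>\<^bsub>A\<^esub>"
proof -
  interpret Grp: group G by fact
  interpret A: comm_group A by fact
  interpret group_hom "G\<lparr>carrier := K\<rparr>" A h
    using assms subgroup.subgroup_is_group[OF assms(2,1)]
    by (simp add: group_hom_def group_hom_axioms_def A.is_group)
  \<comment> \<open>\<open>derived_img\<close> works inside the group carried by \<open>K\<close>;
    \<open>derived_consistent\<close> identifies the derived subgroup computed there with the one
    computed in \<open>G\<close>.\<close>
  have "h ` derived G K = derived A (h ` K)"
    using derived_img[of K] Grp.derived_consistent[OF subset_refl assms(2)] by simp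
  also have "\<dots> = {\<one>\<^bsub>A\<^esub>}"
    using hom_closed by (intro A.derived_eq_singleton) auto
  finally show ?thesis using assms(5) by blast
qed

lemma commutator_in_derived:
  assumes "x \<in> K" "y \<in> K"
  shows "x \<otimes>\<^bsub>G\<^esub> y \<otimes>\<^bsub>G\<^esub> inv\<^bsub>G\<^esub> x \<otimes>\<^bsub>G\<^esub> inv\<^bsub>G\<^esub> y \<in> derived G K"
  unfolding derived_def using assms by (intro generate.incl) blast

text \<open>The group of order two on truth values, chosen so that membership predicates can serve
  directly as homomorphisms.\<close>

definition bool_group :: "bool monoid" where
  "bool_group = \<lparr>carrier = UNIV, monoid.mult = (=), one = True\<rparr>"

lemma comm_group_bool: "comm_group bool_group"
  by (rule comm_groupI) (auto simp: bool_group_def)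

section \<open>The group of order two and its wreath products\<close>

lemma sigma_simps [simp]:
  "sigma (Suc 0) = 2" "sigma 2 = Suc 0" "sigma \<circ> sigma = id" "sigma \<noteq> id"
proof -
  show 1: "sigma (Suc 0) = 2" and "sigma 2 = Suc 0" "sigma \<circ> sigma = id"
    by (simp_all add: sigma_def)
  show "sigma \<noteq> id"
    using 1 by auto
qed

lemma C2_simps [simp]: "monoid.mult C2 = (\<circ>)" "\<one>\<^bsub>C2\<^esub> = id"
  by (simp_all add: C2_def sym_group_def)

lemma carrier_C2 [simp]: "carrier C2 = {id, sigma}"
proof -
  interpret S: group "sym_group 2" by (rule sym_group_is_group)
  have s: "sigma \<in> carrier (sym_group 2)"
    by (simp add: sym_group_carrier sigma_def permutes_swap_id)
  have inv_s: "inv\<^bsub>sym_group 2\<^esub> sigma = sigma"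
    using s by (intro S.inv_equality) (simp_all add: sym_group_mult sym_group_one)
  \<comment> \<open>Since \<open>sigma\<close> is its own inverse, generation stops at these two
    elements.\<close>
  have "x \<in> {id, sigma}" if "x \<in> generate (sym_group 2) {sigma}" for x
    using that by induction (auto simp: sym_group_mult sym_group_one inv_s simp del: id_apply o_apply)
  then show ?thesis
    using generate.one[of "sym_group 2" "{sigma}"] generate.incl[of sigma "{sigma}" "sym_group 2"]
    by (auto simp: C2_def sym_group_one)
qed

lemma wreath_simps [simp]:
  "Wr a b id \<otimes>\<^bsub>wreath_C2 B\<^esub> Wr c d \<rho> = Wr (a \<otimes>\<^bsub>B\<^esub> c) (b \<otimes>\<^bsub>B\<^esub> d) \<rho>"
  "Wr a b sigma \<otimes>\<^bsub>wreath_C2 B\<^esub> Wr c d \<rho> = Wr (a \<otimes>\<^bsub>B\<^esub> d) (b \<otimes>\<^bsub>B\<^esub> c) (sigma \<circ> \<rho>)"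
  "\<one>\<^bsub>wreath_C2 B\<^esub> = Wr \<one>\<^bsub>B\<^esub> \<one>\<^bsub>B\<^esub> id"
  by (simp_all add: wreath_C2_def coord_def)

lemma wreath_carrier_iff [simp]:
  "Wr a b \<pi> \<in> carrier (wreath_C2 B) \<longleftrightarrow> a \<in> carrier B \<and> b \<in> carrier B \<and> \<pi> \<in> {id, sigma}"
  by (auto simp: wreath_C2_def)

lemma wreath_carrierE:
  assumes "x \<in> carrier (wreath_C2 B)"
  obtains a b \<pi> where "x = Wr a b \<pi>" "a \<in> carrier B" "b \<in> carrier B" "\<pi> = id \<or> \<pi> = sigma"
  using assms by (auto simp: wreath_C2_def)

lemma group_base: "group base_group"
proof (rule groupI)
  fix x assume "x \<in> carrier base_group"
  then show "\<exists>y\<in>carrier base_group. y \<otimes>\<^bsub>base_group\<^esub> x = \<one>\<^bsub>base_group\<^esub>"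
    by (auto simp: base_group_def)
qed (auto simp: base_group_def)

lemma group_wreath:
  assumes "group B"
  shows "group (wreath_C2 B)"
proof -
  interpret group B by fact
  show ?thesis
  proof (rule groupI)
    fix x y assume "x \<in> carrier (wreath_C2 B)" "y \<in> carrier (wreath_C2 B)"
    then show "x \<otimes>\<^bsub>wreath_C2 B\<^esub> y \<in> carrier (wreath_C2 B)"
      by (auto elim!: wreath_carrierE)
  next
    fix x y z
    assume "x \<in> carrier (wreath_C2 B)" "y \<in> carrier (wreath_C2 B)" "z \<in> carrier (wreath_C2 B)"
    then show "x \<otimes>\<^bsub>wreath_C2 B\<^esub> y \<otimes>\<^bsub>wreath_C2 B\<^esub> z = x \<otimes>\<^bsub>wreath_C2 B\<^esub> (y \<otimes>\<^bsub>wreath_C2 B\<^esub> z)"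
      by (auto elim!: wreath_carrierE simp: m_assoc simp flip: comp_assoc)
  next
    fix x assume "x \<in> carrier (wreath_C2 B)"
    then show "\<exists>y\<in>carrier (wreath_C2 B). y \<otimes>\<^bsub>wreath_C2 B\<^esub> x = \<one>\<^bsub>wreath_C2 B\<^esub>"
    proof (cases rule: wreath_carrierE)
      case (1 a b \<pi>)
      \<comment> \<open>The first candidate is for \<open>\<pi> = id\<close>; the second, with
        swapped coordinates, is for \<open>\<pi> = sigma\<close>.\<close>
      then have "Wr (inv\<^bsub>B\<^esub> a) (inv\<^bsub>B\<^esub> b) id \<otimes>\<^bsub>wreath_C2 B\<^esub> x = \<one>\<^bsub>wreath_C2 B\<^esub> \<or>
          Wr (inv\<^bsub>B\<^esub> b) (inv\<^bsub>B\<^esub> a) sigma \<otimes>\<^bsub>wreath_C2 B\<^esub> x = \<one>\<^bsub>wreath_C2 B\<^esub>"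
        by auto
      with 1 show ?thesis
        by (metis inv_closed insertCI wreath_carrier_iff)
    qed
  qed (auto elim!: wreath_carrierE)
qed

lemma group_Bgrp: "group (Bgrp n)"
  by (induction n rule: Bgrp.induct) (simp_all add: group_base group_wreath)

section \<open>Subgroups of index at most two\<close>

text \<open>The law \<open>mult_in_N_iff\<close> makes membership in \<open>N\<close> a homomorphism
  to a group of order two with kernel \<open>N\<close>; it encodes both the subgroup property and
  the bound on the index.\<close>

locale index_le_two = group B for B (structure) +
  fixes N :: "'a set"
  assumes N_subset: "N \<subseteq> carrier B"
    and mult_in_N_iff:
      "\<lbrakk>x \<in> carrier B; y \<in> carrier B\<rbrakk> \<Longrightarrow> x \<otimes> y \<in> N \<longleftrightarrow> (x \<in> N \<longleftrightarrow> y \<in> N)"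
begin

lemma one_in_N: "\<one> \<in> N"
  \<comment> \<open>For two equal arguments the right-hand side of the law is true, so every square
    lies in \<open>N\<close>.\<close>
  using mult_in_N_iff[of \<one> \<one>] by simp

lemma inv_in_N_iff: "x \<in> carrier B \<Longrightarrow> inv x \<in> N \<longleftrightarrow> x \<in> N"
  using mult_in_N_iff[of "inv x" x] one_in_N by simp

lemma subgroup_N: "subgroup N B"
  using N_subset one_in_N mult_in_N_iff inv_in_N_iff by unfold_locales (auto simp: subset_iff)

end

text \<open>One step of the recursion for \<open>Gsub\<close>, over an arbitrary base group and
  subset.\<close>

definition wreath_subset :: "wr_elt monoid \<Rightarrow> wr_elt set \<Rightarrow> wr_elt set" where
  "wreath_subset B N =
    {Wr a b \<pi> | a b \<pi>. Wr a b \<pi> \<in> carrier (wreath_C2 B) \<and> a \<otimes>\<^bsub>B\<^esub> b \<in> N}"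

lemma Wr_in_wreath_subset [simp]:
  "Wr a b \<pi> \<in> wreath_subset B N \<longleftrightarrow> Wr a b \<pi> \<in> carrier (wreath_C2 B) \<and> a \<otimes>\<^bsub>B\<^esub> b \<in> N"
  by (auto simp: wreath_subset_def)

text \<open>Modulo \<open>N\<close> the coordinates take values in an abelian group of order at most
  two, so their product is unaffected by the swap and is multiplicative on the wreath
  product.\<close>

lemma index_le_two_wreath:
  assumes "index_le_two B N"
  shows "index_le_two (wreath_C2 B) (wreath_subset B N)"
proof -
  interpret index_le_two B N by fact
  interpret W: group "wreath_C2 B" by (rule group_wreath) (rule is_group)
  show ?thesis
  proof
    show "wreath_subset B N \<subseteq> carrier (wreath_C2 B)"
      by (auto simp: wreath_subset_def)
  next
    fix x y assume "x \<in> carrier (wreath_C2 B)" "y \<in> carrier (wreath_C2 B)"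
    then show "x \<otimes>\<^bsub>wreath_C2 B\<^esub> y \<in> wreath_subset B N \<longleftrightarrow>
        (x \<in> wreath_subset B N \<longleftrightarrow> y \<in> wreath_subset B N)"
      by (auto elim!: wreath_carrierE simp: mult_in_N_iff)
  qed
qed

text \<open>The bottom group has just two elements, so its trivial subgroup has index two.\<close>

lemma index_le_two_base: "index_le_two base_group {\<one>\<^bsub>base_group\<^esub>}"
proof -
  interpret group base_group by (rule group_base)
  show ?thesis
    by unfold_locales (auto simp: base_group_def)
qed

lemma Gsub_Suc_Suc: "Gsub (Suc (Suc n)) = wreath_subset (Bgrp (Suc n)) (Gsub (Suc n))"
  by (simp add: wreath_subset_def)

lemma index_le_two_Gsub: "index_le_two (Bgrp n) (Gsub n)"
proof (induction n rule: Bgrp.induct)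
  case (3 n)
  then show ?case
    unfolding Gsub_Suc_Suc Bgrp.simps by (rule index_le_two_wreath)
qed (simp_all add: index_le_two_base)

section \<open>Necessary conditions from homomorphisms to abelian groups\<close>

locale wreath_index_le_two = index_le_two B N for B :: "wr_elt monoid" (structure) and N
begin

abbreviation W where "W \<equiv> wreath_C2 B"
abbreviation G where "G \<equiv> wreath_subset B N"
abbreviation B' where "B' \<equiv> derived B (carrier B)"

sublocale W: index_le_two W G
  by (rule index_le_two_wreath) unfold_locales

lemma GE:
  assumes "x \<in> G"
  obtains a b \<pi> where "x = Wr a b \<pi>" "a \<in> carrier B" "b \<in> carrier B" "\<pi> = id \<or> \<pi> = sigma"
    "a \<otimes> b \<in> N"
  using assms by (auto simp: wreath_subset_def)

text \<open>The value on \<open>Base\<close>, here and in the next two maps, is a placeholder: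
  \<open>G\<close> consists of \<open>Wr\<close> elements.\<close>

lemma perm_hom: "case_wr_elt (\<lambda>_. False) (\<lambda>a b \<pi>. \<pi> = id) \<in> hom (W\<lparr>carrier := G\<rparr>) bool_group"
  by (rule homI) (auto simp: bool_group_def elim!: GE)

text \<open>On \<open>G\<close> both coordinates have the same class modulo \<open>N\<close>,
  because \<open>a \<otimes> b \<in> N\<close>; hence the swap by \<open>sigma\<close> does not
  disturb the first one.\<close>

lemma fst_hom: "case_wr_elt (\<lambda>_. False) (\<lambda>a b \<pi>. a \<in> N) \<in> hom (W\<lparr>carrier := G\<rparr>) bool_group"
  by (rule homI) (auto simp: bool_group_def mult_in_N_iff elim!: GE)

lemma prod_hom:
  "case_wr_elt (\<lambda>_. {}) (\<lambda>a b \<pi>. B' #> (a \<otimes> b)) \<in> hom (W\<lparr>carrier := G\<rparr>) (B Mod B')"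
proof -
  interpret Q: comm_group "B Mod B'" by (rule derived_quot_is_comm_group)
  interpret D: normal B' B
    using derived_is_normal[OF normal_self] .
  have closed: "B' #> a \<in> carrier (B Mod B')" if "a \<in> carrier B" for a
    using that by (auto simp: carrier_FactGroup)
  have mult: "B' #> (a \<otimes> b) = (B' #> a) \<otimes>\<^bsub>B Mod B'\<^esub> (B' #> b)"
    if "a \<in> carrier B" "b \<in> carrier B" for a b
    using that by (simp add: D.rcos_sum)
  show ?thesis
    by (rule homI) (auto elim!: GE simp: closed mult Q.m_ac simp del: mult_FactGroup)
qed

lemma derived_G_imp:
  assumes "Wr a b \<pi> \<in> derived W G"
  shows "\<pi> = id" "a \<in> N" "b \<in> N" "a \<otimes> b \<in> B'"
proof -
  note kills = derived_hom_comm_group[OF W.is_group W.subgroup_N _ _ assms]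
  have "Wr a b \<pi> \<in> G"
    using assms W.derived_incl[OF subset_refl W.subgroup_N] by blast
  then have ab: "a \<in> carrier B" "b \<in> carrier B" "a \<otimes> b \<in> N"
    by auto
  show "\<pi> = id"
    using kills[OF comm_group_bool perm_hom] by (simp add: bool_group_def)
  show "a \<in> N"
    using kills[OF comm_group_bool fst_hom] by (simp add: bool_group_def)
  then show "b \<in> N"
    using ab mult_in_N_iff by blast
  have "subgroup B' B"
    by (simp add: derived_is_subgroup)
  \<comment> \<open>The identity of the quotient is the coset \<open>B'\<close> itself, so a trivial
    image means membership in \<open>B'\<close>.\<close>
  moreover have "B' #> (a \<otimes> b) = B'"
    using kills[OF derived_quot_is_comm_group prod_hom] by simp
  ultimately show "a \<otimes> b \<in> B'"
    using ab by (metis m_closed rcos_self)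
qed

section \<open>Construction of elements of the derived subgroup\<close>

lemma inv_Wr_id: "\<lbrakk>a \<in> carrier B; b \<in> carrier B\<rbrakk> \<Longrightarrow> inv\<^bsub>W\<^esub> Wr a b id = Wr (inv a) (inv b) id"
  by (rule W.inv_equality) auto

lemma inv_Wr_one_sigma: "inv\<^bsub>W\<^esub> Wr \<one> \<one> sigma = Wr \<one> \<one> sigma"
  by (rule W.inv_equality) auto

lemma derived_G_closed:
  "\<lbrakk>x \<in> derived W G; y \<in> derived W G\<rbrakk> \<Longrightarrow> x \<otimes>\<^bsub>W\<^esub> y \<in> derived W G"
  "x \<in> derived W G \<Longrightarrow> inv\<^bsub>W\<^esub> x \<in> derived W G"
  using W.subgroupE(3,4)[OF W.derived_is_subgroup[OF W.N_subset]] by auto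

lemma antidiagonal_in_derived_G:
  assumes "b \<in> N"
  shows "Wr (inv b) b id \<in> derived W G"
proof -
  have "b \<in> carrier B" "inv b \<in> N"
    using assms N_subset inv_in_N_iff by auto
  then show ?thesis
    using commutator_in_derived[of "Wr (inv b) \<one> id" G "Wr \<one> \<one> sigma" W] one_in_N
    by (simp add: inv_Wr_id inv_Wr_one_sigma)
qed

lemma commutator_fst_in_derived_G_right:
  assumes "x \<in> carrier B" "y \<in> N"
  shows "Wr (x \<otimes> y \<otimes> inv x \<otimes> inv y) \<one> id \<in> derived W G"
proof -
  have "y \<in> carrier B"
    using assms N_subset by auto
  then show ?thesis
    \<comment> \<open>The element \<open>Wr x (inv x) id\<close> is in \<open>G\<close> for every
      \<open>x\<close>, as its coordinates multiply to \<open>\<one>\<close>; only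
      \<open>Wr y \<one> id\<close> requires \<open>y \<in> N\<close>.\<close>
    using assms commutator_in_derived[of "Wr x (inv x) id" G "Wr y \<one> id" W] one_in_N
    by (simp add: inv_Wr_id)
qed

lemma commutator_fst_in_derived_G:
  assumes x: "x \<in> carrier B" and y: "y \<in> carrier B"
  shows "Wr (x \<otimes> y \<otimes> inv x \<otimes> inv y) \<one> id \<in> derived W G"
proof -
  have cancel: "inv u \<otimes> (u \<otimes> v) = v" "u \<otimes> (inv u \<otimes> v) = v"
    if "u \<in> carrier B" "v \<in> carrier B" for u v
    using that by (simp_all flip: m_assoc)
  \<comment> \<open>Inverting a commutator exchanges its arguments, which moves the condition from
    \<open>y\<close> to \<open>x\<close>.\<close>
  have inN: "Wr (x \<otimes> y \<otimes> inv x \<otimes> inv y) \<one> id \<in> derived W G"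
    if "x \<in> N" "y \<in> carrier B" for x y
  proof -
    have x: "x \<in> carrier B"
      using that N_subset by auto
    have "inv\<^bsub>W\<^esub> Wr (y \<otimes> x \<otimes> inv y \<otimes> inv x) \<one> id = Wr (x \<otimes> y \<otimes> inv x \<otimes> inv y) \<one> id"
      using x that by (simp add: inv_Wr_id inv_mult_group m_assoc)
    then show ?thesis
      using derived_G_closed(2)[OF commutator_fst_in_derived_G_right[OF that(2,1)]] by simp
  qed
  show ?thesis
  proof (cases "x \<in> N \<or> y \<in> N")
    case True
    then show ?thesis
      using inN commutator_fst_in_derived_G_right x y by blast
  next
    case False
    \<comment> \<open>With both \<open>x\<close> and \<open>y\<close> outside \<open>N\<close>, the
      product \<open>x \<otimes> y\<close> is inside; the identity
      \<open>[x, y] = [x y, inv x]\<close> puts it into the first argument.\<close>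
    have "x \<otimes> y \<otimes> inv x \<otimes> inv y = (x \<otimes> y) \<otimes> inv x \<otimes> inv (x \<otimes> y) \<otimes> inv (inv x)"
      using x y by (simp add: inv_mult_group m_assoc cancel)
    then show ?thesis
      using inN[of "x \<otimes> y" "inv x"] False x y by (simp add: mult_in_N_iff)
  qed
qed

lemma fst_in_derived_G:
  assumes "c \<in> B'"
  shows "Wr c \<one> id \<in> derived W G"
proof -
  have "Wr c \<one> id \<in> derived W G" if "c \<in> generate B (derived_set B (carrier B))"
    using that
    text \<open>\<open>induction\<close> eta-expands \<open>id\<close>, and \<open>id_apply\<close> would then turn it into \<open>\<lambda>a. a\<close>.\<close>
  proof induction
    case one
    show ?case
      using subgroup.one_closed[OF W.derived_is_subgroup[OF W.N_subset]] by (simp del: id_apply)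
  next
    case (incl h)
    then show ?case
      using commutator_fst_in_derived_G by blast
  next
    case (inv h)
    then obtain x y where h: "h = x \<otimes> y \<otimes> inv x \<otimes> inv y" "x \<in> carrier B" "y \<in> carrier B"
      by auto
    then show ?case
      using derived_G_closed(2)[OF commutator_fst_in_derived_G[OF h(2,3)]]
      by (simp add: inv_Wr_id del: id_apply)
  next
    case (eng h1 h2)
    then show ?case
      using derived_G_closed(1)[OF eng.IH] by (simp del: id_apply)
  qed
  then show ?thesis
    using assms by (simp add: derived_def)
qed

theorem derived_wreath_subset_iff:
  assumes "a \<in> carrier B" "b \<in> carrier B"
  shows "Wr a b \<pi> \<in> derived W G \<longleftrightarrow> \<pi> = id \<and> a \<in> N \<and> b \<in> N \<and> a \<otimes> b \<in> B'"
proof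
  assume R: "\<pi> = id \<and> a \<in> N \<and> b \<in> N \<and> a \<otimes> b \<in> B'"
  then have "Wr (a \<otimes> b) \<one> id \<otimes>\<^bsub>W\<^esub> Wr (inv b) b id \<in> derived W G"
    by (intro derived_G_closed fst_in_derived_G antidiagonal_in_derived_G) auto
  then show "Wr a b \<pi> \<in> derived W G"
    using R assms by (simp add: m_assoc)
qed (use derived_G_imp in blast)

end

theorem lemma11:
  fixes k i :: nat and g1 g2 :: wr_elt
  assumes "k \<ge> 2"
    and "g1 \<in> carrier (Bgrp (k - 1))" and "g2 \<in> carrier (Bgrp (k - 1))"
    and "i \<in> {0, 1}"
  shows "Wr g1 g2 (sigma [^]\<^bsub>C2\<^esub> i) \<in> derived (Bgrp k) (Gsub k) \<longleftrightarrow>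
    i = 0 \<and> g1 \<in> Gsub (k - 1) \<and> g2 \<in> Gsub (k - 1) \<and>
    g1 \<otimes>\<^bsub>Bgrp (k - 1)\<^esub> g2 \<in> derived (Bgrp (k - 1)) (carrier (Bgrp (k - 1)))"
proof -
  obtain n where k: "k = Suc (Suc n)"
    using assms(1) by (metis Suc_le_D numeral_2_eq_2 Suc_le_mono)
  interpret wreath_index_le_two "Bgrp (Suc n)" "Gsub (Suc n)"
    by (rule wreath_index_le_two.intro) (rule index_le_two_Gsub)
  \<comment> \<open>This turns the condition \<open>\<pi> = id\<close> into one on the exponent, as
    \<open>sigma\<close> differs from \<open>id\<close>.\<close>
  have "sigma [^]\<^bsub>C2\<^esub> i = id \<longleftrightarrow> i = 0"
    using assms(4) by (auto simp: nat_pow_def)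
  then show ?thesis
    using derived_wreath_subset_iff[of g1 g2 "sigma [^]\<^bsub>C2\<^esub> i"] assms(2,3)
    unfolding k Gsub_Suc_Suc Bgrp.simps by simp
qed

end
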